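(* Let $X$ be a reflexive real Banach space with dual $X^*$, and let $A, B\colon X\rightrightarrows X^*$ be maximally monotone operators. Assume that $\bigcup_{\lambda>0}\lambda\left[\operatorname{dom}A-\operatorname{dom}B\right]$ is a closed subspace of $X$. Then $A+B$ is maximally monotone.
   Context: A set-valued operator $A\colon X\rightrightarrows X^*$ assigns to each $x\in X$ a (possibly empty) set $Ax\subseteq X^*$. Its graph is $\operatorname{gra}A:=\{(x,x^* )\in X\times X^*\mid x^*\in Ax\}$ and its domain is $\operatorname{dom}A:=\{x\in X\mid Ax\neq\varnothing\}$. The operator $A$ is monotone if $\langle x-y,x^*-y^*\rangle\ge 0$ for all $(x,x^* ),(y,y^* )\in\operatorname{gra}A$, where $\langle\cdot,\cdot\rangle$ is the duality pairing between $X$ and $X^*$. It is maximally monotone if it is monotone and has no proper monotone extension in the sense of graph inclusion. The sum operator $A+B\colon X\rightrightarrows X^*$ is defined by $(A+B)x:=\{a^*+b^*\mid a^*\in Ax,\ b^*\in Bx\}$. For sets, $\lambda[D-E]:=\{\lambda(d-e)\mid d\in D,\ e\in E\}$. *)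

theory Defs
  imports "HOL-Analysis.Analysis"
begin

text \<open>The topological dual, normed by the operator norm.\<close>

type_synonym 'a dual = "'a \<Rightarrow>\<^sub>L real"

definition canonical_embedding :: "'a::real_normed_vector \<Rightarrow> 'a dual dual" where
  "canonical_embedding x = Blinfun (\<lambda>f. blinfun_apply f x)"

text \<open>\<open>Blinfun\<close> is meaningful only on bounded linear maps; evaluation at a point is one.\<close>

lemma canonical_embedding_apply [simp]:
  "blinfun_apply (canonical_embedding x) f = blinfun_apply f x"
  unfolding canonical_embedding_def
  by (simp add: bounded_linear_Blinfun_apply blinfun.bounded_linear_left)

text \<open>Reflexivity is a property of the whole type, hence the \<open>itself\<close> argument.\<close>

definition reflexive_space :: "'a::real_normed_vector itself \<Rightarrow> bool" where
  "reflexive_space _ \<longleftrightarrow> surj (canonical_embedding :: 'a \<Rightarrow> 'a dual dual)"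

type_synonym 'a set_valued_op = "'a \<Rightarrow> 'a dual set"

definition gra :: "'a::real_normed_vector set_valued_op \<Rightarrow> ('a \<times> 'a dual) set" where
  "gra A = {(x, x'). x' \<in> A x}"

definition domain :: "'a::real_normed_vector set_valued_op \<Rightarrow> 'a set" where
  "domain A = {x. A x \<noteq> {}}"

definition monotone_op :: "'a::real_normed_vector set_valued_op \<Rightarrow> bool" where
  "monotone_op A \<longleftrightarrow>
     (\<forall>(x, x') \<in> gra A. \<forall>(y, y') \<in> gra A. blinfun_apply (x' - y') (x - y) \<ge> 0)"

definition maximally_monotone :: "'a::real_normed_vector set_valued_op \<Rightarrow> bool" where
  "maximally_monotone A \<longleftrightarrow>
     monotone_op A \<and> \<not> (\<exists>B. monotone_op B \<and> gra A \<subset> gra B)"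

definition op_sum ::
    "'a::real_normed_vector set_valued_op \<Rightarrow> 'a set_valued_op \<Rightarrow> 'a set_valued_op" where
  "op_sum A B x = {a + b | a b. a \<in> A x \<and> b \<in> B x}"

definition scaled_diff :: "real \<Rightarrow> 'a::real_vector set \<Rightarrow> 'a set \<Rightarrow> 'a set" where
  "scaled_diff r D E = {r *\<^sub>R (d - e) | d e. d \<in> D \<and> e \<in> E}"

end

(* For a point (z, z') monotonically related to the graph of A + B, minimise
     F_A(x1, x1') + F_B(x2, x2') - <z, x1' + x2'> - <x1, z'> + <z, z'>
       + |u - z|^2/2 + |u' - z'|^2/2
   subject to x1 = x2, u = x1, u' = x1' + x2', where F_A, F_B are Fitzpatrick functions; these
   dominate the duality pairing, so the objective is nonnegative.  The domain condition passes
   from A, B to F_A, F_B, so the constraint operator maps the feasible set onto a set spanning a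
   closed subspace, and Baire's theorem together with Hahn-Banach yields a Lagrange multiplier
   (w1, w2, w3).  By reflexivity w3 is evaluation at some v.  Eliminating u and u' shows that
   z' - w2 - w1 and w1 belong to A and B at z - v, and since (z, z') is related to that
   point of the graph of A + B, w2 = 0 and v = 0. *)

theory Submission
  imports Defs
begin

subsection \<open>The Hahn-Banach theorem\<close>

definition sublinear :: "('a::real_vector \<Rightarrow> real) \<Rightarrow> bool" where
  "sublinear p \<longleftrightarrow> (\<forall>x y. p (x + y) \<le> p x + p y) \<and> (\<forall>t x. 0 \<le> t \<longrightarrow> p (t *\<^sub>R x) = t * p x)"

lemma sublinearI:
  assumes "\<And>x y. p (x + y) \<le> p x + p y" and "p 0 = 0"
    and le: "\<And>t x. 0 < t \<Longrightarrow> p (t *\<^sub>R x) \<le> t * p x"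
  shows "sublinear p"
proof -
  have "t * p x \<le> p (t *\<^sub>R x)" if "0 < t" for t x
  proof -
    have "p (inverse t *\<^sub>R (t *\<^sub>R x)) \<le> inverse t * p (t *\<^sub>R x)"
      using that by (intro le) auto
    with that show ?thesis by (simp add: field_simps)
  qed
  with assms show ?thesis
    unfolding sublinear_def by (metis antisym less_eq_real_def mult_zero_left scale_zero_left)
qed

lemma
  assumes "sublinear p"
  shows sublinear_add: "p (x + y) \<le> p x + p y"
    and sublinear_scaleR: "0 \<le> t \<Longrightarrow> p (t *\<^sub>R x) = t * p x"
    and sublinear_zero: "p 0 = 0"
    and sublinear_minus: "- p (- x) \<le> p x"
proof -
  have add: "\<forall>x y. p (x + y) \<le> p x + p y"
    and scale: "\<forall>t x. 0 \<le> t \<longrightarrow> p (t *\<^sub>R x) = t * p x"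
    using assms unfolding sublinear_def by auto
  show "p (x + y) \<le> p x + p y" and "0 \<le> t \<Longrightarrow> p (t *\<^sub>R x) = t * p x"
    using add scale by auto
  from scale[rule_format, of 0 0] show zero: "p 0 = 0" by simp
  from add[rule_format, of x "- x"] show "- p (- x) \<le> p x" by (simp add: zero)
qed

section \<open>Linear minorants of sublinear functionals\<close>

text \<open>For sublinear \<open>p\<close>, this is the largest sublinear functional below
  \<open>p\<close> whose value at \<open>- y\<close> is at most \<open>- p y\<close>. It lowers
  \<open>p\<close> just enough to make it linear along \<open>y\<close>.\<close>

definition descent :: "('a::real_vector \<Rightarrow> real) \<Rightarrow> 'a \<Rightarrow> 'a \<Rightarrow> real" where
  "descent p y x = (INF t\<in>{0..}. p (x + t *\<^sub>R y) - t * p y)"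

lemma descent_bdd:
  assumes p: "sublinear p"
  shows "bdd_below ((\<lambda>t. p (x + t *\<^sub>R y) - t * p y) ` {0..})"
proof (rule bdd_belowI2)
  fix t :: real assume "t \<in> {0..}"
  then have "t * p y \<le> p (x + t *\<^sub>R y) + p (- x)"
    using sublinear_add[OF p, of "x + t *\<^sub>R y" "- x"] sublinear_scaleR[OF p, of t y] by simp
  then show "- p (- x) \<le> p (x + t *\<^sub>R y) - t * p y" by simp
qed

lemma descent_le:
  assumes "sublinear p" "0 \<le> t"
  shows "descent p y x \<le> p (x + t *\<^sub>R y) - t * p y"
  unfolding descent_def using assms by (intro cINF_lower descent_bdd) auto

lemma descent_greatest:
  assumes "\<And>t. 0 \<le> t \<Longrightarrow> c \<le> p (x + t *\<^sub>R y) - t * p y"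
  shows "c \<le> descent p y x"
  unfolding descent_def using assms by (intro cINF_greatest) auto

text \<open>Parameters \<open>t\<close> for \<open>x\<close> and \<open>s\<close> for
  \<open>z\<close> combine to the parameter \<open>t + s\<close> for \<open>x + z\<close>, which
  gives subadditivity. For homogeneity the parameter is rescaled together with the point.\<close>

lemma sublinear_descent:
  assumes p: "sublinear p"
  shows "sublinear (descent p y)"
proof (rule sublinearI)
  fix x z
  have "descent p y (x + z) - descent p y x \<le> p (z + s *\<^sub>R y) - s * p y" if s: "0 \<le> s" for s
  proof -
    have "descent p y (x + z) - (p (z + s *\<^sub>R y) - s * p y) \<le> p (x + t *\<^sub>R y) - t * p y"
      if t: "0 \<le> t" for t
    proof -
      have "descent p y (x + z) \<le> p ((x + z) + (t + s) *\<^sub>R y) - (t + s) * p y"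
        using s t by (intro descent_le p) auto
      also have "(x + z) + (t + s) *\<^sub>R y = (x + t *\<^sub>R y) + (z + s *\<^sub>R y)"
        by (simp add: algebra_simps)
      finally show ?thesis
        using sublinear_add[OF p, of "x + t *\<^sub>R y" "z + s *\<^sub>R y"] by (simp add: algebra_simps)
    qed
    from descent_greatest[OF this] show ?thesis by (simp add: algebra_simps)
  qed
  from descent_greatest[OF this]
  show "descent p y (x + z) \<le> descent p y x + descent p y z" by simp
next
  have "0 \<le> descent p y 0"
    by (rule descent_greatest) (simp add: sublinear_scaleR[OF p])
  with descent_le[OF p, of 0 y 0] show "descent p y 0 = 0" by (simp add: sublinear_zero[OF p])
next
  fix t :: real and x assume t: "0 < t"
  have "descent p y (t *\<^sub>R x) / t \<le> p (x + s *\<^sub>R y) - s * p y" if s: "0 \<le> s" for s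
  proof -
    have "descent p y (t *\<^sub>R x) \<le> p (t *\<^sub>R x + (t * s) *\<^sub>R y) - (t * s) * p y"
      using s t by (intro descent_le p) auto
    also have "t *\<^sub>R x + (t * s) *\<^sub>R y = t *\<^sub>R (x + s *\<^sub>R y)" by (simp add: algebra_simps)
    also have "p \<dots> = t * p (x + s *\<^sub>R y)" using t by (intro sublinear_scaleR p) auto
    finally show ?thesis using t by (simp add: field_simps)
  qed
  from descent_greatest[OF this] t show "descent p y (t *\<^sub>R x) \<le> t * descent p y x"
    by (simp add: field_simps)
qed

lemma descent_le_self: "sublinear p \<Longrightarrow> descent p y x \<le> p x"
  using descent_le[of p 0 y x] by simp

lemma descent_minus: "sublinear p \<Longrightarrow> descent p y (- y) \<le> - p y"
  using descent_le[of p 1 y "- y"] by (simp add: sublinear_zero)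

text \<open>Provides the lower bounds for Zorn's lemma. The infimum is finite because every member
  stays above \<open>- p (- x)\<close>, and it is subadditive because two members of a chain have a
  smaller one.\<close>

lemma sublinear_INF_chain:
  assumes C: "C \<noteq> {}" "\<And>q. q \<in> C \<Longrightarrow> sublinear q"
    and le: "\<And>q x. q \<in> C \<Longrightarrow> q x \<le> p x"
    and chain: "\<And>q r. q \<in> C \<Longrightarrow> r \<in> C \<Longrightarrow> r \<le> q \<or> q \<le> r"
  shows "sublinear (\<lambda>x. INF q\<in>C. q x)" and "q \<in> C \<Longrightarrow> (INF q\<in>C. q x) \<le> q x"
proof -
  have bdd: "bdd_below ((\<lambda>q. q x) ` C)" for x
  proof (rule bdd_belowI2)
    fix q assume q: "q \<in> C"
    show "- p (- x) \<le> q x"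
      using sublinear_minus[OF C(2)[OF q], of x] le[OF q, of "- x"] by simp
  qed
  then show lower: "q \<in> C \<Longrightarrow> (INF q\<in>C. q x) \<le> q x" for q x
    by (rule cINF_lower)
  have greatest: "c \<le> (INF q\<in>C. q x)" if "\<And>q. q \<in> C \<Longrightarrow> c \<le> q x" for c x
    using that C(1) by (intro cINF_greatest)
  show "sublinear (\<lambda>x. INF q\<in>C. q x)"
  proof (rule sublinearI)
    fix x y
    have "(INF q\<in>C. q (x + y)) - (INF q\<in>C. q x) \<le> r y" if r: "r \<in> C" for r
    proof -
      have "(INF q\<in>C. q (x + y)) - r y \<le> q x" if q: "q \<in> C" for q
      proof -
        \<comment> \<open>The smaller of \<open>q\<close> and \<open>r\<close> serves at both
          arguments at once; for an arbitrary family this would fail.\<close>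
        from chain[OF q r] obtain s where s: "s \<in> C" "s \<le> q" "s \<le> r" using q r by blast
        have "(INF q\<in>C. q (x + y)) \<le> s (x + y)" by (rule lower[OF s(1)])
        also have "\<dots> \<le> s x + s y" by (rule sublinear_add[OF C(2)[OF s(1)]])
        also have "\<dots> \<le> q x + r y" using s(2,3) by (intro add_mono) (auto simp: le_fun_def)
        finally show ?thesis by simp
      qed
      then have "(INF q\<in>C. q (x + y)) - r y \<le> (INF q\<in>C. q x)" by (rule greatest)
      then show ?thesis by (simp add: algebra_simps)
    qed
    then have "(INF q\<in>C. q (x + y)) - (INF q\<in>C. q x) \<le> (INF q\<in>C. q y)" by (rule greatest)
    then show "(INF q\<in>C. q (x + y)) \<le> (INF q\<in>C. q x) + (INF q\<in>C. q y)" by simp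
  next
    show "(INF q\<in>C. q 0) = (0 :: real)"
      using C by (simp add: sublinear_zero cong: INF_cong)
  next
    fix t :: real and x assume t: "0 < t"
    have "(INF q\<in>C. q (t *\<^sub>R x)) / t \<le> q x" if q: "q \<in> C" for q
      using lower[OF q, of "t *\<^sub>R x"] sublinear_scaleR[OF C(2)[OF q], of t x] t
      by (simp add: field_simps)
    then have "(INF q\<in>C. q (t *\<^sub>R x)) / t \<le> (INF q\<in>C. q x)" by (rule greatest)
    with t show "(INF q\<in>C. q (t *\<^sub>R x)) \<le> t * (INF q\<in>C. q x)"
      by (simp add: field_simps)
  qed
qed

text \<open>A minimal sublinear functional equals each of its descents, hence is odd, hence linear.\<close>

theorem sublinear_dominates_linear:
  fixes p :: "'a::real_vector \<Rightarrow> real"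
  assumes p: "sublinear p"
  obtains f where "linear f" "\<And>x. f x \<le> p x"
proof -
  define A where "A = {q :: 'a \<Rightarrow> real. sublinear q \<and> q \<le> p}"
  have "\<exists>m\<in>A. \<forall>q\<in>A. q \<le> m \<longrightarrow> q = m"
  proof (rule predicate_Zorn)
    \<comment> \<open>The order is reversed, so that the maximal element given by Zorn's lemma is a
      minimal sublinear functional.\<close>
    show "partial_order_on A (relation_of (\<lambda>q r. r \<le> q) A)"
      by (rule partial_order_on_relation_ofI) auto
  next
    fix C assume ch: "C \<in> Chains (relation_of (\<lambda>q r. r \<le> q) A)"
    show "\<exists>u\<in>A. \<forall>a\<in>C. u \<le> a"
    proof (cases "C = {}")
      case True
      with p show ?thesis unfolding A_def by auto
    next
      case False
      have CA: "C \<subseteq> A" by (rule Chains_relation_of[OF ch])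
      have *: "q \<in> C \<Longrightarrow> sublinear q" "q \<in> C \<Longrightarrow> q x \<le> p x"
        for q r x
        using CA by (auto simp: A_def le_fun_def)
      have chain: "q \<in> C \<Longrightarrow> r \<in> C \<Longrightarrow> r \<le> q \<or> q \<le> r" for q r
        using ch unfolding Chains_def relation_of_def by blast
      have inf: "sublinear (\<lambda>x. INF q\<in>C. q x)"
        by (rule sublinear_INF_chain(1)[where p = p], rule False, erule *(1), erule *(2), rule chain, assumption+)
      have le: "(INF q\<in>C. q x) \<le> r x" if "r \<in> C" for r x
        by (rule sublinear_INF_chain(2)[where p = p], rule False, erule *(1), erule *(2), rule chain, assumption+)
          (rule that)
      have "(\<lambda>x. INF q\<in>C. q x) \<le> p"
        using False le *(2) unfolding le_fun_def by (metis all_not_in_conv order_trans)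
      with inf le show ?thesis
        by (intro bexI[of _ "\<lambda>x. INF q\<in>C. q x"]) (auto simp: A_def le_fun_def)
    qed
  qed
  then obtain m where m: "sublinear m" "m \<le> p"
    and minimal: "\<And>q. sublinear q \<Longrightarrow> q \<le> m \<Longrightarrow> q = m"
    unfolding A_def using order_trans by blast
  have "descent m y = m" for y
    by (rule minimal) (auto simp: sublinear_descent m le_fun_def descent_le_self)
  then have odd: "m (- y) = - m y" for y
    using descent_minus[OF m(1), of y] sublinear_minus[OF m(1), of y] by simp
  have "linear m"
  proof (rule linearI)
    fix x y
    show "m (x + y) = m x + m y"
      using sublinear_add[OF m(1), of x y] sublinear_add[OF m(1), of "- x" "- y"]
        odd[of "x + y"] odd[of x] odd[of y] by simp
  next
    fix t x
    show "m (t *\<^sub>R x) = t *\<^sub>R m x"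
    proof (cases "0 \<le> t")
      case False
      then show ?thesis
        using sublinear_scaleR[OF m(1), of "- t" x] odd[of "t *\<^sub>R x"] by simp
    qed (simp add: sublinear_scaleR[OF m(1)])
  qed
  with m(2) show ?thesis by (intro that) (auto simp: le_fun_def)
qed

section \<open>Continuous linear minorants and separation\<close>

lemma bounded_linear_dominated:
  fixes f :: "'a::real_normed_vector \<Rightarrow> real"
  assumes "linear f" and le: "\<And>x. f x \<le> C * norm x"
  shows "bounded_linear f"
proof -
  have "norm (f x) \<le> norm x * C" for x
    using le[of x] le[of "- x"] linear_neg[OF assms(1)] by (simp add: mult.commute abs_le_iff)
  with assms(1) show ?thesis
    by (intro bounded_linear_intro) (auto simp: linear_add linear_scale)
qed

text \<open>The infimal convolution \<open>p\<close> of the lower boundary of \<open>W\<close> with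
  \<open>C * norm\<close> is finite by the lower bound on \<open>W\<close>, and sublinear because
  \<open>W\<close> is a convex cone. A linear minorant of \<open>p\<close> is continuous, as
  \<open>p u\<close> is at most \<open>C * norm u\<close>, and it lies below \<open>W\<close>, as
  \<open>p s\<close> is at most \<open>c\<close> for \<open>(s, c)\<close> in
  \<open>W\<close>.\<close>

theorem cone_dominated_by_dual:
  fixes W :: "('a::real_normed_vector \<times> real) set"
  assumes zero: "(0, 0) \<in> W"
    and add: "\<And>v w. v \<in> W \<Longrightarrow> w \<in> W \<Longrightarrow> v + w \<in> W"
    and scale: "\<And>t v. 0 < t \<Longrightarrow> v \<in> W \<Longrightarrow> t *\<^sub>R v \<in> W"
    and C: "0 \<le> C" and lower: "\<And>s c. (s, c) \<in> W \<Longrightarrow> - C * norm s \<le> c"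
  obtains f :: "'a dual" where "\<And>s c. (s, c) \<in> W \<Longrightarrow> f s \<le> c"
proof -
  define p where "p u = (INF w\<in>W. snd w + C * norm (u - fst w))" for u
  have bdd: "bdd_below ((\<lambda>w. snd w + C * norm (u - fst w)) ` W)" for u
  proof (rule bdd_belowI2)
    fix w assume "w \<in> W"
    with lower[of "fst w" "snd w"] have "- C * norm (fst w) \<le> snd w" by simp
    moreover have "C * norm (fst w) \<le> C * (norm u + norm (u - fst w))"
      using C norm_triangle_sub[of "fst w" u] by (intro mult_left_mono) (auto simp: norm_minus_commute)
    ultimately show "- C * norm u \<le> snd w + C * norm (u - fst w)" by (simp add: algebra_simps)
  qed
  have p_le: "p u \<le> c + C * norm (u - s)" if "(s, c) \<in> W" for u s c
    using cINF_lower[OF bdd that, of u] by (simp add: p_def)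
  have le_p: "a \<le> p u" if "\<And>s c. (s, c) \<in> W \<Longrightarrow> a \<le> c + C * norm (u - s)" for a u
    unfolding p_def using zero that by (intro cINF_greatest) auto
  have "sublinear p"
  proof (rule sublinearI)
    fix x y
    have "p (x + y) - p x \<le> c + C * norm (y - s)" if sc: "(s, c) \<in> W" for s c
    proof -
      have "p (x + y) - (c + C * norm (y - s)) \<le> d + C * norm (x - r)" if rd: "(r, d) \<in> W" for r d
      proof -
        have "p (x + y) \<le> (c + d) + C * norm ((x + y) - (s + r))"
          using add[OF sc rd] by (intro p_le) simp
        also have "(x + y) - (s + r) = (x - r) + (y - s)" by simp
        also have "C * norm \<dots> \<le> C * (norm (x - r) + norm (y - s))"
          using C by (intro mult_left_mono norm_triangle_ineq)
        finally show ?thesis by (simp add: algebra_simps)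
      qed
      from le_p[OF this] show ?thesis by (simp add: algebra_simps)
    qed
    from le_p[OF this] show "p (x + y) \<le> p x + p y" by simp
  next
    have "0 \<le> p 0" using lower by (intro le_p) (force simp: algebra_simps)
    with p_le[OF zero, of 0] show "p 0 = 0" by simp
  next
    fix t :: real and x assume t: "0 < t"
    have "p (t *\<^sub>R x) / t \<le> c + C * norm (x - s)" if sc: "(s, c) \<in> W" for s c
    proof -
      have "p (t *\<^sub>R x) \<le> t * c + C * norm (t *\<^sub>R x - t *\<^sub>R s)"
        using scale[OF t sc] by (intro p_le) simp
      also have "norm (t *\<^sub>R x - t *\<^sub>R s) = t * norm (x - s)"
        using t by (simp flip: scaleR_diff_right)
      finally show ?thesis using t by (simp add: field_simps)
    qed
    from le_p[OF this] t show "p (t *\<^sub>R x) \<le> t * p x" by (simp add: field_simps)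
  qed
  then obtain f where f: "linear f" "\<And>x. f x \<le> p x" by (rule sublinear_dominates_linear) blast
  have "f x \<le> C * norm x" for x
    using f(2)[of x] p_le[OF zero, of x] by simp
  with f(1) have "bounded_linear f" by (rule bounded_linear_dominated)
  moreover have "f s \<le> c" if "(s, c) \<in> W" for s c
    using f(2)[of s] p_le[OF that, of s] by simp
  ultimately show ?thesis
    by (intro that[of "Blinfun f"]) (simp add: bounded_linear_Blinfun_apply)
qed

text \<open>The separating functional is dominated on the cone generated by the graph of 0 over \<open>S\<close>
  and \<open>(-x, -dist(x, S))\<close>.\<close>

lemma separate_closed_subspace:
  fixes S :: "'a::real_normed_vector set"
  assumes S: "subspace S" "closed S" and x: "x \<notin> S"
  obtains f :: "'a dual" where "\<And>s. s \<in> S \<Longrightarrow> f s = 0" "0 < f x"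
proof -
  have ne: "S \<noteq> {}" using subspace_0[OF S(1)] by auto
  define d where "d = infdist x S"
  have d: "0 < d"
    using S(2) x ne unfolding d_def by (metis in_closed_iff_infdist_zero infdist_nonneg less_eq_real_def)
  define W where "W = {(s - t *\<^sub>R x, - t * d) | s t. s \<in> S \<and> 0 \<le> t}"
  have lower: "- 1 * norm u \<le> c" if "(u, c) \<in> W" for u c
  proof -
    from that obtain s t where s: "s \<in> S" and t: "0 \<le> t" and u: "u = s - t *\<^sub>R x" and c: "c = - t * d"
      unfolding W_def by auto
    have "t * d \<le> norm u"
    proof (cases "t = 0")
      case False
      \<comment> \<open>Dividing by \<open>t\<close> keeps \<open>s\<close> in the subspace, so
        \<open>- u\<close> is \<open>t\<close> times the difference between \<open>x\<close> and a
        point of \<open>S\<close>.\<close>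
      have "d \<le> dist x ((1 / t) *\<^sub>R s)"
        unfolding d_def by (rule infdist_le) (rule subspace_scale[OF S(1) s])
      then have "t * d \<le> t * norm (x - (1 / t) *\<^sub>R s)"
        using t by (intro mult_left_mono) (auto simp: dist_norm)
      also have "\<dots> = norm (t *\<^sub>R (x - (1 / t) *\<^sub>R s))" using t by simp
      also have "t *\<^sub>R (x - (1 / t) *\<^sub>R s) = - u" using False by (simp add: u algebra_simps)
      finally show ?thesis by simp
    qed simp
    with c show ?thesis by simp
  qed
  have W: "(s - t *\<^sub>R x, - t * d) \<in> W" if "s \<in> S" "0 \<le> t" for s t
    using that unfolding W_def by blast
  have zero: "(0, 0) \<in> W"
    using W[OF subspace_0[OF S(1)], of 0] by simp
  have add: "v + w \<in> W" if "v \<in> W" "w \<in> W" for v w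
  proof -
    from that obtain s t s' t' where "s \<in> S" "0 \<le> t" "v = (s - t *\<^sub>R x, - t * d)"
      "s' \<in> S" "0 \<le> t'" "w = (s' - t' *\<^sub>R x, - t' * d)" unfolding W_def by auto
    then show ?thesis
      using W[OF subspace_add[OF S(1), of s s'], of "t + t'"] by (simp add: algebra_simps)
  qed
  have scale: "r *\<^sub>R v \<in> W" if "0 < r" "v \<in> W" for r v
  proof -
    from that obtain s t where "s \<in> S" "0 \<le> t" "v = (s - t *\<^sub>R x, - t * d)"
      unfolding W_def by auto
    then show ?thesis
      using W[OF subspace_scale[OF S(1), of s r], of "r * t"] that(1) by (simp add: algebra_simps)
  qed
  obtain f :: "'a dual" where f: "\<And>u c. (u, c) \<in> W \<Longrightarrow> f u \<le> c"
    using cone_dominated_by_dual[OF zero add scale zero_le_one lower] by blast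
  show ?thesis
  proof (rule that)
    fix s assume s: "s \<in> S"
    have "f s' \<le> 0" if "s' \<in> S" for s'
      using f[OF W[OF that, of 0]] by simp
    from this[OF s] this[OF subspace_neg[OF S(1) s]] show "f s = 0"
      by (simp add: blinfun.minus_right)
  next
    have "f (- x) \<le> - d"
      using f[OF W[OF subspace_0[OF S(1)], of 1]] by simp
    with d show "0 < f x" by (simp add: blinfun.minus_right)
  qed
qed

subsection \<open>Lagrange multipliers in Banach spaces\<close>

text \<open>The weights 1/2, 1/4, ... sum to 1, so the series is an infinite convex combination. A
  partial sum becomes a finite one once the leftover weight \<open>(1/2) ^ n\<close> is put on some
  point of \<open>K\<close>; in the limit this correction vanishes.\<close>

lemma convex_halving_series:
  fixes K :: "'a::banach set"
  assumes K: "convex K" "closed K" "bounded K" and e: "\<And>i. e i \<in> K"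
  shows "summable (\<lambda>i. (1/2) ^ Suc i *\<^sub>R e i)" and "(\<Sum>i. (1/2) ^ Suc i *\<^sub>R e i) \<in> K"
proof -
  obtain R where R: "\<And>x. x \<in> K \<Longrightarrow> norm x \<le> R" using K(3) unfolding bounded_iff by blast
  show sm: "summable (\<lambda>i. (1/2) ^ Suc i *\<^sub>R e i)"
  proof (rule summable_comparison_test')
    have "summable (\<lambda>i. (1/2::real) ^ i)" by (rule summable_geometric) simp
    then show "summable (\<lambda>i. R * (1/2) ^ i * (1/2))" by (intro summable_mult summable_mult2)
    show "norm ((1/2) ^ Suc n *\<^sub>R e n) \<le> R * (1/2) ^ n * (1/2)" for n
      using R[OF e, of n] by (simp add: field_simps)
  qed
  have part: "(\<Sum>i<n. (1/2) ^ Suc i *\<^sub>R e i) + (1/2) ^ n *\<^sub>R k \<in> K" if "k \<in> K" for n k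
    using that
  proof (induction n arbitrary: k)
    case (Suc n)
    have "(1/2) *\<^sub>R e n + (1/2) *\<^sub>R k \<in> K"
      using K(1) e Suc.prems by (intro convexD) auto
    from Suc.IH[OF this] show ?case by (simp add: scaleR_add_right add.assoc mult.commute)
  qed simp
  have "(\<lambda>n. (1/2::real) ^ n) \<longlonglongrightarrow> 0" by (rule LIMSEQ_power_zero) simp
  then have "(\<lambda>n. (\<Sum>i<n. (1/2) ^ Suc i *\<^sub>R e i) + (1/2) ^ n *\<^sub>R e 0) \<longlonglongrightarrow>
      (\<Sum>i. (1/2) ^ Suc i *\<^sub>R e i) + 0 *\<^sub>R e 0"
    by (intro tendsto_add tendsto_scaleR summable_LIMSEQ sm tendsto_const)
  then show "(\<Sum>i. (1/2) ^ Suc i *\<^sub>R e i) \<in> K"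
    using closed_sequentially[OF K(2)] part[OF e] by fastforce
qed

text \<open>Successive approximation as in the open mapping theorem, with convex combinations in
  place of sums. The doubled residual \<open>2 *\<^sub>R z - T e\<close> falls back into the ball of
  radius \<open>d / 2\<close>, so the step repeats, and the chosen points form a halving series
  whose image is \<open>y\<close>.\<close>

lemma convex_image_contains_ball:
  fixes K :: "'a::banach set" and T :: "'a \<Rightarrow>\<^sub>L 'b::real_normed_vector"
  assumes K: "convex K" "closed K" "bounded K"
    and S: "subspace S" "\<And>x. x \<in> K \<Longrightarrow> T x \<in> S"
    and d: "0 < d" and dense: "\<And>y. y \<in> S \<Longrightarrow> norm y < d \<Longrightarrow> y \<in> closure (T ` K)"
    and y: "y \<in> S" "norm y < d / 2"
  shows "y \<in> T ` K"
proof -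
  have "\<exists>e\<in>K. norm (2 *\<^sub>R z - T e) < d / 2" if "z \<in> S" "norm z < d / 2" for z
  proof -
    have "2 *\<^sub>R z \<in> closure (T ` K)" using that S(1) by (intro dense) (auto simp: subspace_scale)
    with d obtain e where "e \<in> K" "dist (T e) (2 *\<^sub>R z) < d / 2"
      unfolding closure_approachable by (metis half_gt_zero imageE)
    then show ?thesis by (auto simp: dist_norm norm_minus_commute)
  qed
  then obtain pick where pick: "pick z \<in> K" "norm (2 *\<^sub>R z - T (pick z)) < d / 2"
    if "z \<in> S" "norm z < d / 2" for z by metis
  define z where "z n = ((\<lambda>z. 2 *\<^sub>R z - T (pick z)) ^^ n) y" for n
  define e where "e n = pick (z n)" for n
  have z0: "z 0 = y" and zS: "z (Suc n) = 2 *\<^sub>R z n - T (e n)" for n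
    by (simp_all add: z_def e_def)
  have zn: "z n \<in> S \<and> norm (z n) < d / 2" for n
  proof (induction n)
    case (Suc n)
    then show ?case
      unfolding zS e_def using pick S by (simp add: subspace_diff subspace_scale)
  qed (use y in \<open>simp add: z0\<close>)
  then have e: "e n \<in> K" for n by (simp add: e_def pick)
  note series = convex_halving_series[OF K, of e, OF e]
  have part: "y = T (\<Sum>i<n. (1/2) ^ Suc i *\<^sub>R e i) + (1/2) ^ n *\<^sub>R z n" for n
  proof (induction n)
    case (Suc n)
    then show ?case
      by (simp add: zS blinfun.add_right blinfun.scaleR_right scaleR_diff_right)
  qed (simp add: z0)
  have "(\<lambda>n. T (\<Sum>i<n. (1/2) ^ Suc i *\<^sub>R e i)) \<longlonglongrightarrow> T (\<Sum>i. (1/2) ^ Suc i *\<^sub>R e i)"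
    by (intro blinfun.tendsto tendsto_const summable_LIMSEQ series)
  moreover have "(\<lambda>n. (1/2) ^ n *\<^sub>R z n) \<longlonglongrightarrow> 0"
  proof (rule Lim_null_comparison)
    show "\<forall>\<^sub>F n in sequentially. norm ((1/2) ^ n *\<^sub>R z n) \<le> (1/2) ^ n * (d / 2)"
      using zn by (intro always_eventually allI) (auto intro!: mult_mono less_imp_le)
    have "(\<lambda>n. (1/2::real) ^ n) \<longlonglongrightarrow> 0" by (rule LIMSEQ_power_zero) simp
    from tendsto_mult_left_zero[OF this] show "(\<lambda>n. (1/2) ^ n * (d / 2)) \<longlonglongrightarrow> 0" .
  qed
  ultimately have "(\<lambda>n. T (\<Sum>i<n. (1/2) ^ Suc i *\<^sub>R e i) + (1/2) ^ n *\<^sub>R z n) \<longlonglongrightarrow>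
      T (\<Sum>i. (1/2) ^ Suc i *\<^sub>R e i) + 0" by (rule tendsto_add)
  then have "y = T (\<Sum>i. (1/2) ^ Suc i *\<^sub>R e i)"
    unfolding part[symmetric] by (simp add: LIMSEQ_const_iff)
  with series(2) show ?thesis by blast
qed

text \<open>Multiples of the \<open>A n\<close> cover the complete space \<open>S\<close>, so by
  Baire the closure of one multiple has an interior point \<open>s\<close> relative to
  \<open>S\<close>. Averaging a neighbourhood of \<open>s\<close> with \<open>- s\<close> moves the
  interior point to 0.\<close>

lemma absorbing_convex_chain_dense_ball:
  fixes A :: "nat \<Rightarrow> 'a::banach set"
  assumes S: "subspace S" "closed S"
    and A: "mono A" "\<And>n. convex (A n)" "\<And>n. 0 \<in> A n" "\<And>n. A n \<subseteq> S"
    and cover: "\<And>s. s \<in> S \<Longrightarrow> \<exists>n r. 0 < r \<and> s \<in> (*\<^sub>R) r ` A n"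
  obtains n d where "0 < d" "\<And>y. y \<in> S \<Longrightarrow> norm y < d \<Longrightarrow> y \<in> closure (A n)"
proof -
  \<comment> \<open>The factor grows with the index, so one large index accommodates both the set
    and the multiple; being nonzero, it can be divided out at the end.\<close>
  define D where "D n = (*\<^sub>R) (real (Suc n)) ` A n" for n
  \<comment> \<open>Since 0 lies in \<open>A n\<close>, convexity rewrites a smaller multiple of
    \<open>a\<close> as the full multiple of a point of \<open>A n\<close>.\<close>
  have D_I: "r *\<^sub>R a \<in> D n" if "a \<in> A k" "k \<le> n" "0 \<le> r" "r \<le> real (Suc n)" for r a k n
  proof -
    have "a \<in> A n" using A(1) that(1,2) unfolding mono_def by blast
    then have "(r / real (Suc n)) *\<^sub>R a + (1 - r / real (Suc n)) *\<^sub>R 0 \<in> A n"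
      using that(3,4) A(2,3) by (intro convexD) (auto simp: divide_le_eq_1 simp del: of_nat_Suc)
    moreover have "r *\<^sub>R a = real (Suc n) *\<^sub>R ((r / real (Suc n)) *\<^sub>R a)" by (simp del: of_nat_Suc)
    ultimately show ?thesis unfolding D_def by (intro image_eqI) auto
  qed
  have D_mono: "D m \<subseteq> D n" if "m \<le> n" for m n
    using D_I that by (auto simp: D_def[of m])
  have DS: "closure (D n) \<subseteq> S" for n
    using A(4) S by (intro closure_minimal) (auto simp: D_def intro!: subspace_scale)
  have D_convex: "convex (closure (D n))" for n
    unfolding D_def by (intro convex_closure convex_scaling A)
  have S_sub: "S \<subseteq> (\<Union>n. closure (D n))"
  proof
    fix s assume "s \<in> S"
    from cover[OF this] obtain k r a where "0 < r" "a \<in> A k" "s = r *\<^sub>R a" by blast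
    moreover obtain m where "r \<le> real m" using real_arch_simple by blast
    ultimately have "s \<in> D (max k m)" by (auto intro!: D_I[of _ k])
    then show "s \<in> (\<Union>n. closure (D n))" using closure_subset by blast
  qed
  have "\<exists>n. (top_of_set S) interior_of closure (D n) \<noteq> {}"
  proof (rule ccontr)
    assume "\<not> ?thesis"
    moreover have "completely_metrizable_space (top_of_set S)"
      using S(2) by (intro completely_metrizable_space_closedin completely_metrizable_space_euclidean) simp
    moreover have "closedin (top_of_set S) (closure (D n))" for n
      using DS S(2) by (simp add: closedin_closed_eq)
    ultimately have "(top_of_set S) interior_of (\<Union>(range (\<lambda>n. closure (D n)))) = {}"
      by (intro Baire_category_alt) auto
    moreover have "\<Union>(range (\<lambda>n. closure (D n))) = S" using S_sub DS by auto
    moreover have "(top_of_set S) interior_of S = S"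
      by (metis interior_of_topspace topspace_euclidean_subtopology)
    ultimately show False using subspace_0[OF S(1)] by auto
  qed
  then obtain n U s where U: "openin (top_of_set S) U" "s \<in> U" "U \<subseteq> closure (D n)"
    unfolding interior_of_def by blast
  then obtain d where d: "0 < d" "\<And>x. x \<in> S \<Longrightarrow> dist x s < d \<Longrightarrow> x \<in> U" and s: "s \<in> S"
    unfolding openin_euclidean_subtopology_iff by blast
  obtain m where m: "- s \<in> closure (D m)" using S_sub subspace_neg[OF S(1) s] by blast
  define N where "N = max n m"
  have nN: "closure (D n) \<subseteq> closure (D N)" and mN: "closure (D m) \<subseteq> closure (D N)"
    by (auto simp: N_def intro!: closure_mono D_mono)
  \<comment> \<open>In the radius, the factor 2 pays for the averaging with \<open>- s\<close>, and
    \<open>Suc N\<close> for passing from \<open>D N\<close> back to \<open>A N\<close>.\<close>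
  have "y \<in> closure (A N)" if y: "y \<in> S" "norm y < d / (2 * real (Suc N))" for y
  proof -
    define x where "x = (2 * real (Suc N)) *\<^sub>R y"
    have "norm x = (2 * real (Suc N)) * norm y" unfolding x_def by simp
    also have "\<dots> < d" using y(2) by (simp add: field_simps)
    finally have "s + x \<in> closure (D n)"
      using y(1) s S(1) U(3) by (intro subsetD[OF U(3)] d(2)) (auto simp: x_def dist_norm subspace_add subspace_scale)
    then have "(1/2) *\<^sub>R (s + x) + (1/2) *\<^sub>R (- s) \<in> closure (D N)"
      using m nN mN by (intro convexD[OF D_convex]) auto
    then have "real (Suc N) *\<^sub>R y \<in> (*\<^sub>R) (real (Suc N)) ` closure (A N)"
      unfolding D_def closure_scaleR by (simp add: x_def algebra_simps)
    then show ?thesis by (auto simp del: of_nat_Suc)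
  qed
  with d(1) show ?thesis by (intro that[of "d / (2 * real (Suc N))"]) auto
qed

text \<open>Assumption \<open>cone\<close> is the Attouch-Brezis qualification. It makes the value function
  \<open>y \<mapsto> inf {g e | T e = y}\<close> bounded above near 0 in \<open>S\<close>, so the cone \<open>W\<close> generated by its
  epigraph satisfies the lower bound needed for a continuous linear minorant.\<close>

theorem lagrange_multiplier:
  fixes T :: "'v::banach \<Rightarrow>\<^sub>L 'y::banach" and g :: "'v \<Rightarrow> real"
  assumes E: "convex E" "closed E"
    and g: "convex_on E g" "continuous_on E g"
    and S: "subspace S" "closed S" and TE: "\<And>e. e \<in> E \<Longrightarrow> T e \<in> S"
    and cone: "\<And>s. s \<in> S \<Longrightarrow> \<exists>r e. 0 < r \<and> e \<in> E \<and> s = r *\<^sub>R T e"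
    and nonneg: "\<And>e. e \<in> E \<Longrightarrow> T e = 0 \<Longrightarrow> 0 \<le> g e"
  obtains w :: "'y dual" where "\<And>e. e \<in> E \<Longrightarrow> 0 \<le> g e + w (T e)"
proof -
  from cone[OF subspace_0[OF S(1)]] obtain e0 where e0: "e0 \<in> E" "T e0 = 0" by auto
  define R where "R = max (norm e0) (g e0)"
  \<comment> \<open>Truncating \<open>g\<close> produces the bound \<open>M\<close> near 0;
    truncating the norm gives the boundedness required by the halving series.\<close>
  define K where "K n = {e \<in> E. g e \<le> R + real n} \<inter> cball 0 (R + real n)" for n
  have K: "convex (K n)" "closed (K n)" "bounded (K n)" for n
  proof -
    have "convex {e \<in> E. g e \<le> R + real n}" 
    proof (rule convexI)
      fix x y and u v :: real
      assume xy: "x \<in> {e \<in> E. g e \<le> R + real n}" "y \<in> {e \<in> E. g e \<le> R + real n}"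
        and uv: "0 \<le> u" "0 \<le> v" "u + v = 1"
      have "g (u *\<^sub>R x + v *\<^sub>R y) \<le> u * g x + v * g y"
        using g(1) xy uv unfolding convex_on_def by blast
      also have "\<dots> \<le> R + real n" using xy uv by (intro convex_bound_le) auto
      finally show "u *\<^sub>R x + v *\<^sub>R y \<in> {e \<in> E. g e \<le> R + real n}"
        using convexD[OF E(1) _ _ uv] xy by simp
    qed
    then show "convex (K n)" unfolding K_def by (intro convex_Int convex_cball)
    have "closed {e \<in> E. g e \<le> R + real n}"
      using continuous_closed_preimage[OF g(2) E(2) closed_atMost, of "R + real n"]
      by (simp add: vimage_def Int_def)
    then show "closed (K n)" unfolding K_def by (intro closed_Int closed_cball)
    show "bounded (K n)" unfolding K_def by (intro bounded_Int) auto
  qed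
  have "e0 \<in> K n" for n using e0(1) unfolding K_def R_def by (auto simp: le_max_iff_disj)
  then have zero: "0 \<in> T ` K n" for n using e0(2) by force
  have cover: "\<exists>n r. 0 < r \<and> s \<in> (*\<^sub>R) r ` T ` K n" if "s \<in> S" for s
  proof -
    from cone[OF that] obtain r e where re: "0 < r" "e \<in> E" "s = r *\<^sub>R T e" by blast
    obtain n where "max (norm e - R) (g e - R) \<le> real n" using real_arch_simple by blast
    with re show ?thesis by (intro exI[of _ n] exI[of _ r]) (auto simp: K_def)
  qed
  have mono: "mono (\<lambda>n. T ` K n)"
    by (auto simp: mono_def K_def intro!: imageI)
  have conv: "convex (T ` K n)" for n
    by (intro convex_linear_image K bounded_linear.linear[OF blinfun.bounded_linear_right])
  have sub: "T ` K n \<subseteq> S" for n by (auto simp: K_def TE)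
  obtain n d where d: "0 < d" and dense: "\<And>y. y \<in> S \<Longrightarrow> norm y < d \<Longrightarrow> y \<in> closure (T ` K n)"
    using absorbing_convex_chain_dense_ball[OF S mono conv zero sub cover] by blast
  define M where "M = R + real n"
  have R: "0 \<le> R" unfolding R_def by (simp add: le_max_iff_disj)
  then have M: "0 \<le> M" by (simp add: M_def)
  have ball: "\<exists>e\<in>E. T e = y \<and> g e \<le> M" if "y \<in> S" "norm y < d / 2" for y
  proof -
    have "y \<in> T ` K n"
      by (rule convex_image_contains_ball[OF K S(1) _ d dense that]) (auto simp: K_def TE)
    then show ?thesis by (auto simp: K_def M_def)
  qed
  \<comment> \<open>By convexity, two scaled points merge into one point with the added scale. This
    makes \<open>W\<close> closed under addition and lets a constraint violation be
    cancelled.\<close>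
  have combine: "\<exists>e\<in>E. (r + r') *\<^sub>R T e = r *\<^sub>R T a + r' *\<^sub>R T b \<and> (r + r') * g e \<le> r * g a + r' * g b"
    if "a \<in> E" "b \<in> E" "0 \<le> r" "0 \<le> r'" "0 < r + r'" for a b r r'
  proof -
    define t where "t = r / (r + r')"
    have t: "0 \<le> t" "0 \<le> 1 - t" "t + (1 - t) = 1"
      using that by (auto simp: t_def divide_le_eq_1)
    have tr: "(r + r') * t = r" using that(5) by (simp add: t_def)
    then have tr': "(r + r') * (1 - t) = r'" by (simp add: right_diff_distrib)
    let ?e = "t *\<^sub>R a + (1 - t) *\<^sub>R b"
    have "?e \<in> E" by (rule convexD[OF E(1) that(1,2) t])
    moreover have "(r + r') *\<^sub>R T ?e = ((r + r') * t) *\<^sub>R T a + ((r + r') * (1 - t)) *\<^sub>R T b"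
      by (simp add: blinfun.add_right blinfun.scaleR_right scaleR_add_right)
    moreover have "g ?e \<le> t * g a + (1 - t) * g b"
      using g(1) that(1,2) t unfolding convex_on_def by blast
    then have "(r + r') * g ?e \<le> (r + r') * (t * g a + (1 - t) * g b)"
      using that(5) by (intro mult_left_mono) auto
    then have "(r + r') * g ?e \<le> ((r + r') * t) * g a + ((r + r') * (1 - t)) * g b"
      by (simp add: distrib_left mult.assoc)
    ultimately show ?thesis unfolding tr tr' by blast
  qed
  define W where "W = {(r *\<^sub>R T e, c) | r e c. 0 \<le> r \<and> e \<in> E \<and> r * g e \<le> c}"
  have W: "(r *\<^sub>R T e, c) \<in> W" if "0 \<le> r" "e \<in> E" "r * g e \<le> c" for r e c
    using that unfolding W_def by blast
  have lower: "- (4 * M / d) * norm s \<le> c" if "(s, c) \<in> W" for s c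
  proof -
    from that obtain r e where re: "0 \<le> r" "e \<in> E" "r * g e \<le> c" and s: "s = r *\<^sub>R T e"
      unfolding W_def by blast
    show ?thesis
    proof (cases "s = 0")
      case True
      have "0 \<le> r * g e"
      proof (cases "r = 0")
        case False
        with True s have "T e = 0" by simp
        with nonneg re show ?thesis by simp
      qed simp
      with True re show ?thesis by simp
    next
      case False
      with s re have r: "0 < r" by (cases "r = 0") auto
      \<comment> \<open>With this scale the point \<open>(- 1 / r') *\<^sub>R s\<close> has norm
        \<open>d / 4\<close> and is thus attained by some \<open>e'\<close> of value at most
        \<open>M\<close>. Merging \<open>r\<close> times \<open>e\<close> with \<open>r'\<close>
        times \<open>e'\<close> cancels \<open>s\<close> and gives a feasible point, where
        \<open>g\<close> is nonnegative.\<close>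
      define r' where "r' = 4 * norm s / d"
      have r': "0 < r'" using False d by (simp add: r'_def)
      have "(- 1 / r') *\<^sub>R s \<in> S" using s re TE S(1) by (simp add: subspace_scale subspace_neg)
      moreover have "norm ((- 1 / r') *\<^sub>R s) < d / 2" using False d by (simp add: r'_def)
      ultimately obtain e' where e': "e' \<in> E" "T e' = (- 1 / r') *\<^sub>R s" "g e' \<le> M"
        using ball by blast
      from combine[OF re(2) e'(1), of r r'] r r' obtain a where
        a: "a \<in> E" "(r + r') *\<^sub>R T a = r *\<^sub>R T e + r' *\<^sub>R T e'" "(r + r') * g a \<le> r * g e + r' * g e'"
        by auto
      have "(r + r') *\<^sub>R T a = 0" using r' by (simp add: a(2) e'(2) s)
      then have "T a = 0" using r r' by simp
      then have "0 \<le> (r + r') * g a" using nonneg a(1) r r' by simp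
      also note a(3)
      also have "r * g e + r' * g e' \<le> c + r' * M"
        using re(3) e'(3) r' by (intro add_mono mult_left_mono) auto
      finally show ?thesis by (simp add: r'_def mult_ac)
    qed
  qed
  have W0: "(0, 0) \<in> W" using W[of 0 e0 0] e0(1) by simp
  have add: "v + w \<in> W" if "v \<in> W" "w \<in> W" for v w
  proof -
    from that obtain r a c r' b c' where v: "v = (r *\<^sub>R T a, c)" "0 \<le> r" "a \<in> E" "r * g a \<le> c"
      and w: "w = (r' *\<^sub>R T b, c')" "0 \<le> r'" "b \<in> E" "r' * g b \<le> c'" unfolding W_def by blast
    show ?thesis
    proof (cases "r + r' = 0")
      case True
      with v w have "r = 0" "r' = 0" by auto
      with v w W[of 0 a "c + c'"] show ?thesis by simp
    next
      case False
      with v w have "0 < r + r'" by simp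
      from combine[OF v(3) w(3) v(2) w(2) this] obtain e where e: "e \<in> E"
        "(r + r') *\<^sub>R T e = r *\<^sub>R T a + r' *\<^sub>R T b" "(r + r') * g e \<le> r * g a + r' * g b" by blast
      with v w W[of "r + r'" e "c + c'"] show ?thesis by simp
    qed
  qed
  have scale: "t *\<^sub>R v \<in> W" if "0 < t" "v \<in> W" for t v
  proof -
    from that(2) obtain r a c where v: "v = (r *\<^sub>R T a, c)" "0 \<le> r" "a \<in> E" "r * g a \<le> c"
      unfolding W_def by blast
    with that(1) W[of "t * r" a "t * c"] show ?thesis by (simp add: mult.assoc)
  qed
  have "0 \<le> 4 * M / d" using M d by simp
  from cone_dominated_by_dual[OF W0 add scale this lower] obtain f :: "'y dual"
    where f: "\<And>s c. (s, c) \<in> W \<Longrightarrow> f s \<le> c" by blast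
  show ?thesis
  proof (rule that)
    fix e assume "e \<in> E"
    then have "f (T e) \<le> g e" using f[OF W[of 1 e "g e"]] by simp
    then show "0 \<le> g e + (- f) (T e)" by (simp add: blinfun.minus_left)
  qed
qed

subsection \<open>Maximally monotone operators\<close>

lemma norm_diff_square_convex:
  assumes "0 \<le> a" "0 \<le> b" "a + b = (1::real)"
  shows "(norm (a *\<^sub>R x + b *\<^sub>R y - z))\<^sup>2 \<le> a * (norm (x - z))\<^sup>2 + b * (norm (y - z))\<^sup>2"
proof -
  have "a *\<^sub>R (x - z) + b *\<^sub>R (y - z) = a *\<^sub>R x + b *\<^sub>R y - (a + b) *\<^sub>R z"
    by (simp add: algebra_simps)
  then have "a *\<^sub>R x + b *\<^sub>R y - z = a *\<^sub>R (x - z) + b *\<^sub>R (y - z)"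
    using assms(3) by simp
  then have "norm (a *\<^sub>R x + b *\<^sub>R y - z) \<le> a * norm (x - z) + b * norm (y - z)"
    using assms by (metis abs_of_nonneg norm_scaleR norm_triangle_ineq)
  then have "(norm (a *\<^sub>R x + b *\<^sub>R y - z))\<^sup>2 \<le> (a * norm (x - z) + b * norm (y - z))\<^sup>2"
    by (rule power_mono) simp
  also have "\<dots> \<le> a * (norm (x - z))\<^sup>2 + b * (norm (y - z))\<^sup>2"
    using convex_power2 assms unfolding convex_on_def by simp
  finally show ?thesis .
qed

text \<open>The conjugate of half the squared norm is half the squared dual norm. Optimising along
  each line through 0 bounds \<open>w x\<close> by \<open>sqrt (- 2 * c) * norm x\<close>, hence the
  operator norm.\<close>

lemma half_square_conjugate:
  fixes w :: "'a::real_normed_vector dual"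
  assumes le: "\<And>u. c \<le> (norm u)\<^sup>2 / 2 - w u"
  shows "c \<le> - (norm w)\<^sup>2 / 2"
proof -
  have c: "c \<le> 0" using le[of 0] by simp
  have "norm (w x) \<le> sqrt (- 2 * c) * norm x" for x
  proof (cases "x = 0")
    case False
    \<comment> \<open>This \<open>t\<close> minimises the right-hand side of the hypothesis along
      the multiples of \<open>x\<close>.\<close>
    define t where "t = w x / (norm x)\<^sup>2"
    have "c \<le> t\<^sup>2 * (norm x)\<^sup>2 / 2 - t * w x"
      using le[of "t *\<^sub>R x"] by (simp add: power_mult_distrib blinfun.scaleR_right)
    also have "t\<^sup>2 * (norm x)\<^sup>2 = t * w x"
      using False by (simp add: t_def power2_eq_square)
    finally have "t * w x \<le> - 2 * c" by simp
    then have "(w x)\<^sup>2 \<le> - 2 * c * (norm x)\<^sup>2"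
      using False by (simp add: t_def field_simps power2_eq_square)
    then have "sqrt ((w x)\<^sup>2) \<le> sqrt (- 2 * c * (norm x)\<^sup>2)" by (rule real_sqrt_le_mono)
    then show ?thesis by (simp only: real_sqrt_mult real_sqrt_abs) simp
  qed simp
  then have "norm w \<le> sqrt (- 2 * c)" using c by (intro norm_blinfun_bound) auto
  then have "(norm w)\<^sup>2 \<le> (sqrt (- 2 * c))\<^sup>2" by (rule power_mono) simp
  with c show ?thesis by simp
qed

lemma half_squares_conjugate:
  fixes w :: "'a::real_normed_vector dual" and w' :: "'b::real_normed_vector dual"
  assumes le: "\<And>u u'. c \<le> (norm u)\<^sup>2 / 2 + (norm u')\<^sup>2 / 2 - w u - w' u'"
  shows "c \<le> - (norm w)\<^sup>2 / 2 - (norm w')\<^sup>2 / 2"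
proof -
  have "c + (norm w)\<^sup>2 / 2 \<le> (norm u')\<^sup>2 / 2 - w' u'" for u'
  proof -
    have "c - (norm u')\<^sup>2 / 2 + w' u' \<le> (norm u)\<^sup>2 / 2 - w u" for u
      using le[of u u'] by simp
    from half_square_conjugate[OF this] show ?thesis by simp
  qed
  from half_square_conjugate[OF this] show ?thesis by simp
qed

lemma dual_prod3_split:
  fixes w :: "('a::real_normed_vector \<times> 'b::real_normed_vector \<times> 'c::real_normed_vector) dual"
  obtains w1 :: "'a dual" and w2 :: "'b dual" and w3 :: "'c dual"
  where "\<And>p q r. w (p, q, r) = w1 p + w2 q + w3 r"
proof -
  have bl: "bounded_linear (\<lambda>p. w (p, 0, 0))" "bounded_linear (\<lambda>q. w (0, q, 0))"
    "bounded_linear (\<lambda>r. w (0, 0, r))"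
    by (intro bounded_linear_compose[OF blinfun.bounded_linear_right] bounded_linear_Pair
        bounded_linear_ident bounded_linear_zero)+
  show ?thesis
  proof (rule that)
    fix p q r
    have "w (p, q, r) = w (p, 0, 0) + w (0, q, 0) + w (0, 0, r)"
      by (simp flip: blinfun.add_right)
    then show "w (p, q, r) = Blinfun (\<lambda>p. w (p, 0, 0)) p + Blinfun (\<lambda>q. w (0, q, 0)) q
        + Blinfun (\<lambda>r. w (0, 0, r)) r"
      by (simp only: bl[THEN bounded_linear_Blinfun_apply])
  qed
qed

section \<open>Pointwise form of maximal monotonicity\<close>

text \<open>A point monotonically related to the whole graph can be added to it without losing
  monotonicity, so maximality forces it to be there already. Conversely, every point of a monotone
  extension is related to the original graph.\<close>

lemma maximally_monotone_iff:
  fixes A :: "'a::real_normed_vector set_valued_op"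
  shows "maximally_monotone A \<longleftrightarrow> (\<forall>x x'. x' \<in> A x \<longleftrightarrow> (\<forall>y y'. y' \<in> A y \<longrightarrow> 0 \<le> (x' - y') (x - y)))"
  (is "_ \<longleftrightarrow> ?R")
proof
  assume A: "maximally_monotone A"
  then have mono: "0 \<le> (x' - y') (x - y)" if "x' \<in> A x" "y' \<in> A y" for x x' y y'
    using that unfolding maximally_monotone_def monotone_op_def gra_def by auto
  show ?R
  proof (intro allI iffI)
    fix x x' assume rel: "\<forall>y y'. y' \<in> A y \<longrightarrow> 0 \<le> (x' - y') (x - y)"
    define B where "B = A(x := insert x' (A x))"
    have rel': "0 \<le> (y' - x') (y - x)" if "y' \<in> A y" for y y'
      using rel[rule_format, OF that] by (simp add: blinfun.diff_left blinfun.diff_right)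
    have B_E: "u' \<in> A u \<or> u = x \<and> u' = x'" if "u' \<in> B u" for u u'
      using that by (auto simp: B_def split: if_splits)
    have "0 \<le> (u' - v') (u - v)" if "u' \<in> B u" "v' \<in> B v" for u u' v v'
      using B_E[OF that(1)] B_E[OF that(2)] mono[of u' u v' v] rel rel'
      by (elim disjE conjE) simp_all
    then have "monotone_op B" unfolding monotone_op_def gra_def by auto
    moreover have "gra A \<subseteq> gra B" by (auto simp: gra_def B_def)
    ultimately have "gra B \<subseteq> gra A" using A unfolding maximally_monotone_def by blast
    moreover have "(x, x') \<in> gra B" by (simp add: gra_def B_def)
    ultimately have "(x, x') \<in> gra A" by (rule subsetD)
    then show "x' \<in> A x" by (simp add: gra_def)
  qed (auto intro: mono)
next
  assume R: ?R
  then have "0 \<le> (x' - y') (x - y)" if "x' \<in> A x" "y' \<in> A y" for x x' y y'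
    using that by blast
  then have "monotone_op A" unfolding monotone_op_def gra_def by auto
  moreover have "gra B \<subseteq> gra A" if B: "monotone_op B" "gra A \<subseteq> gra B" for B
  proof -
    have "x' \<in> A x" if x: "x' \<in> B x" for x x'
    proof (rule R[rule_format, THEN iffD2], intro strip)
      fix y y' assume "y' \<in> A y"
      then have "y' \<in> B y" using B(2) by (auto simp: gra_def)
      with x B(1) show "0 \<le> (x' - y') (x - y)" unfolding monotone_op_def gra_def by auto
    qed
    then show ?thesis by (auto simp: gra_def)
  qed
  ultimately show "maximally_monotone A" unfolding maximally_monotone_def by blast
qed

lemma maximally_monotone_mono:
  "maximally_monotone A \<Longrightarrow> x' \<in> A x \<Longrightarrow> y' \<in> A y \<Longrightarrow> 0 \<le> (x' - y') (x - y)"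
  unfolding maximally_monotone_iff by blast

lemma maximally_monotone_memI:
  assumes "maximally_monotone A" "\<And>y y'. y' \<in> A y \<Longrightarrow> 0 \<le> (x' - y') (x - y)"
  shows "x' \<in> A x"
  using assms unfolding maximally_monotone_iff by blast

section \<open>Fitzpatrick functions through their epigraphs\<close>

text \<open>The epigraph of the Fitzpatrick function, the supremum of the left-hand sides over the
  graph. Working with the epigraph avoids infinite values: the height \<open>t\<close> becomes one
  more variable of a real-valued problem.\<close>

definition fitzpatrick_epi :: "'a::real_normed_vector set_valued_op \<Rightarrow> ('a \<times> 'a dual \<times> real) set" where
  "fitzpatrick_epi A = {(x, x', t).
    \<forall>y y'. y' \<in> A y \<longrightarrow> blinfun_apply y' x + blinfun_apply x' y - blinfun_apply y' y \<le> t}"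

lemma fitzpatrick_epiD:
  "(x, x', t) \<in> fitzpatrick_epi A \<Longrightarrow> y' \<in> A y \<Longrightarrow> y' x + x' y - y' y \<le> t"
  unfolding fitzpatrick_epi_def by blast

lemma convex_fitzpatrick_epi: "convex (fitzpatrick_epi A)"
proof (rule convexI)
  fix p q :: "'a \<times> 'a dual \<times> real" and u v :: real
  assume pq: "p \<in> fitzpatrick_epi A" "q \<in> fitzpatrick_epi A" and uv: "0 \<le> u" "0 \<le> v" "u + v = 1"
  obtain x x' t z z' s where p: "p = (x, x', t)" and q: "q = (z, z', s)" by (metis prod.collapse)
  have "y' (u *\<^sub>R x + v *\<^sub>R z) + (u *\<^sub>R x' + v *\<^sub>R z') y - y' y \<le> u * t + v * s" if "y' \<in> A y" for y y'
  proof -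
    have "y' (u *\<^sub>R x + v *\<^sub>R z) + (u *\<^sub>R x' + v *\<^sub>R z') y - y' y
        = y' (u *\<^sub>R x + v *\<^sub>R z) + (u *\<^sub>R x' + v *\<^sub>R z') y - (u + v) * y' y" by (simp add: uv)
    also have "\<dots> = u * (y' x + x' y - y' y) + v * (y' z + z' y - y' y)"
      by (simp add: blinfun.bilinear_simps algebra_simps)
    also have "\<dots> \<le> u * t + v * s"
      using pq[unfolded p q, THEN fitzpatrick_epiD, OF that] uv by (intro add_mono mult_left_mono) auto
    finally show ?thesis .
  qed
  then show "u *\<^sub>R p + v *\<^sub>R q \<in> fitzpatrick_epi A"
    by (auto simp: p q fitzpatrick_epi_def)
qed

lemma closed_fitzpatrick_epi: "closed (fitzpatrick_epi A)"
proof -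
  have "fitzpatrick_epi A =
      {p. \<forall>y y'. y' \<in> A y \<longrightarrow>
        blinfun_apply y' (fst p) + blinfun_apply (fst (snd p)) y - blinfun_apply y' y \<le> snd (snd p)}"
    by (auto simp: fitzpatrick_epi_def)
  also have "closed \<dots>"
    by (intro closed_Collect_all closed_Collect_imp open_Collect_const closed_Collect_le
        continuous_intros)
  finally show ?thesis .
qed

lemma graph_fitzpatrick_epi:
  assumes "maximally_monotone A" "x' \<in> A x"
  shows "(x, x', x' x) \<in> fitzpatrick_epi A"
proof -
  have "y' x + x' y - y' y \<le> x' x" if "y' \<in> A y" for y y'
    using maximally_monotone_mono[OF assms that] by (simp add: blinfun.bilinear_simps)
  then show ?thesis by (simp add: fitzpatrick_epi_def)
qed

text \<open>If \<open>t\<close> were below \<open>x' x\<close>, the Fitzpatrick inequality would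
  relate \<open>(x, x')\<close> to the graph, so maximality would put it there. The inequality at
  \<open>(x, x')\<close> itself then reads \<open>x' x \<le> t\<close>.\<close>

lemma pairing_le_fitzpatrick_epi:
  assumes A: "maximally_monotone A" and e: "(x, x', t) \<in> fitzpatrick_epi A"
  shows "x' x \<le> t"
proof (rule ccontr)
  assume *: "\<not> x' x \<le> t"
  have "x' \<in> A x"
  proof (rule maximally_monotone_memI[OF A])
    fix y y' assume "y' \<in> A y"
    from fitzpatrick_epiD[OF e this] * show "0 \<le> (x' - y') (x - y)"
      by (simp add: blinfun.bilinear_simps)
  qed
  from fitzpatrick_epiD[OF e this] * show False by simp
qed

text \<open>Otherwise adding large multiples of a functional separating \<open>x - b\<close> from \<open>S\<close> to \<open>x'\<close>
  would put \<open>x\<close> into the domain of \<open>A\<close>.\<close>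

lemma fitzpatrick_epi_diff_mem_subspace:
  assumes A: "maximally_monotone A" and e: "(x, x', t) \<in> fitzpatrick_epi A"
    and S: "subspace S" "closed S" and dom: "\<And>a. a \<in> domain A \<Longrightarrow> a - b \<in> S"
  shows "x - b \<in> S"
proof (rule ccontr)
  assume "x - b \<notin> S"
  then obtain f :: "'a dual" where f: "\<And>s. s \<in> S \<Longrightarrow> f s = 0" "0 < f (x - b)"
    using separate_closed_subspace[OF S] by blast
  \<comment> \<open>Since \<open>f\<close> vanishes on \<open>y - b\<close>, the multiple
    \<open>r\<close> of \<open>f\<close> contributes exactly \<open>\<bar>t - x' x\<bar>\<close> at
    \<open>x - y\<close>, which covers the possible deficit in the Fitzpatrick inequality.\<close>
  define r where "r = \<bar>t - x' x\<bar> / f (x - b)"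
  have "x' + r *\<^sub>R f \<in> A x"
  proof (rule maximally_monotone_memI[OF A])
    fix y y' assume y: "y' \<in> A y"
    then have "y - b \<in> S" by (intro dom) (auto simp: domain_def)
    from f(1)[OF this] have "f (x - y) = f (x - b)" by (simp add: blinfun.diff_right)
    then have "r * f (x - y) = \<bar>t - x' x\<bar>" using f(2) by (simp add: r_def)
    moreover have "(x' + r *\<^sub>R f - y') (x - y) = (x' - y') (x - y) + r * f (x - y)"
      by (simp add: blinfun.bilinear_simps algebra_simps)
    ultimately show "0 \<le> (x' + r *\<^sub>R f - y') (x - y)"
      using fitzpatrick_epiD[OF e y] by (simp add: blinfun.bilinear_simps)
  qed
  then have "x - b \<in> S" by (intro dom) (auto simp: domain_def)
  with f show False by fastforce
qed

section \<open>The constrained minimisation and the sum theorem\<close>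

lemma maximally_monotone_sum_mem:
  fixes A B :: "'a::banach set_valued_op"
  assumes refl: "reflexive_space TYPE('a)"
    and A: "maximally_monotone A" and B: "maximally_monotone B"
    and S_eq: "S = (\<Union>r\<in>{0<..}. scaled_diff r (domain A) (domain B))"
    and S: "subspace S" "closed S"
    and rel: "\<And>x x1 x2. x1 \<in> A x \<Longrightarrow> x2 \<in> B x \<Longrightarrow> 0 \<le> (z' - (x1 + x2)) (z - x)"
  obtains x1 x2 where "x1 \<in> A z" "x2 \<in> B z" "z' = x1 + x2"
proof -
  have diff: "a - b \<in> S" if "a \<in> domain A" "b \<in> domain B" for a b
    using that unfolding S_eq scaled_diff_def by (force intro!: bexI[of _ 1])
  have S_E: "\<exists>r a b. 0 < r \<and> a \<in> domain A \<and> b \<in> domain B \<and> s = r *\<^sub>R (a - b)" if "s \<in> S" for s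
    using that unfolding S_eq scaled_diff_def by auto
  \<comment> \<open>As 0 lies in \<open>S\<close>, both domains are nonempty; \<open>a0\<close> and
    \<open>b0\<close> serve as base points.\<close>
  from S_E[OF subspace_0[OF S(1)]] obtain a0 b0 where ab0: "a0 \<in> domain A" "b0 \<in> domain B"
    by blast
  define E :: "(('a \<times> 'a dual \<times> real) \<times> ('a \<times> 'a dual \<times> real) \<times> ('a \<times> 'a dual)) set"
    where "E = fitzpatrick_epi A \<times> fitzpatrick_epi B \<times> UNIV"
  define T0 :: "('a \<times> 'a dual \<times> real) \<times> ('a \<times> 'a dual \<times> real) \<times> ('a \<times> 'a dual) \<Rightarrow> 'a \<times> 'a \<times> 'a dual"
    where "T0 e = (fst (fst e) - fst (fst (snd e)), fst (fst e) - fst (snd (snd e)),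
      fst (snd (fst e)) + fst (snd (fst (snd e))) - snd (snd (snd e)))" for e
  define T where "T = Blinfun T0"
  have "bounded_linear T0"
    unfolding T0_def
    by (intro bounded_linear_Pair bounded_linear_add bounded_linear_sub
        bounded_linear_fst_comp bounded_linear_snd_comp bounded_linear_ident)
  then have T: "T ((x1, x1', t1), (x2, x2', t2), (u, u')) = (x1 - x2, x1 - u, x1' + x2' - u')"
    for x1 x1' t1 x2 x2' t2 u u'
    by (simp add: T_def bounded_linear_Blinfun_apply) (simp add: T0_def)
  define g where "g = (\<lambda>e :: ('a \<times> 'a dual \<times> real) \<times> ('a \<times> 'a dual \<times> real) \<times> ('a \<times> 'a dual).
    snd (snd (fst e)) + snd (snd (fst (snd e))) - blinfun_apply (fst (snd (fst e)) + fst (snd (fst (snd e)))) z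
    - z' (fst (fst e)) + z' z + (norm (fst (snd (snd e)) - z))\<^sup>2 / 2
    + (norm (snd (snd (snd e)) - z'))\<^sup>2 / 2)"
  have g: "g ((x1, x1', t1), (x2, x2', t2), (u, u')) =
      t1 + t2 - (x1' + x2') z - z' x1 + z' z + (norm (u - z))\<^sup>2 / 2 + (norm (u' - z'))\<^sup>2 / 2"
    for x1 x1' t1 x2 x2' t2 u u' by (simp add: g_def)
  have "continuous_on E g" unfolding g_def by (intro continuous_intros) auto
  moreover have "convex E" "closed E"
    unfolding E_def by (intro convex_Times closed_Times convex_fitzpatrick_epi closed_fitzpatrick_epi
        convex_UNIV closed_UNIV)+
  moreover have "convex_on E g"
    unfolding convex_on_def
  proof (intro conjI strip \<open>convex E\<close>)
    fix p q and a b :: real assume "p \<in> E" "q \<in> E" and ab: "0 \<le> a" "0 \<le> b" "a + b = 1"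
    obtain x1 x1' t1 x2 x2' t2 u u' where p: "p = ((x1, x1', t1), (x2, x2', t2), (u, u'))"
      by (metis prod.collapse)
    obtain y1 y1' s1 y2 y2' s2 v v' where q: "q = ((y1, y1', s1), (y2, y2', s2), (v, v'))"
      by (metis prod.collapse)
    have "z' z = (a + b) * z' z" by (simp add: ab)
    with norm_diff_square_convex[OF ab, of u v z] norm_diff_square_convex[OF ab, of u' v' z']
    show "g (a *\<^sub>R p + b *\<^sub>R q) \<le> a * g p + b * g q"
      by (simp add: p q g blinfun.bilinear_simps algebra_simps)
  qed
  \<comment> \<open>Only the first constraint restricts the range: the free variables
    \<open>u\<close> and \<open>u'\<close> make the other two components arbitrary.\<close>
  moreover have "subspace (S \<times> (UNIV :: ('a \<times> 'a dual) set))" "closed (S \<times> (UNIV :: ('a \<times> 'a dual) set))"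
    using S by (auto intro!: subspace_Times closed_Times)
  moreover have "T e \<in> S \<times> UNIV" if "e \<in> E" for e
  proof -
    obtain x1 x1' t1 x2 x2' t2 u u' where e: "e = ((x1, x1', t1), (x2, x2', t2), (u, u'))"
      by (metis prod.collapse)
    with that have epi: "(x1, x1', t1) \<in> fitzpatrick_epi A" "(x2, x2', t2) \<in> fitzpatrick_epi B"
      by (auto simp: E_def)
    have "x1 - b0 \<in> S"
      using ab0 diff by (intro fitzpatrick_epi_diff_mem_subspace[OF A epi(1) S])
    moreover have "b - a0 \<in> S" if "b \<in> domain B" for b
      using subspace_neg[OF S(1) diff[OF ab0(1) that]] by simp
    then have "x2 - a0 \<in> S"
      by (intro fitzpatrick_epi_diff_mem_subspace[OF B epi(2) S])
    \<comment> \<open>The combination telescopes to \<open>x1 - x2\<close>, the first component of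
      the constraint.\<close>
    ultimately have "(x1 - b0) - (x2 - a0) - (a0 - b0) \<in> S"
      using diff[OF ab0] subspace_diff[OF S(1)] by blast
    then show ?thesis by (simp add: e T)
  qed
  moreover have "\<exists>r e. 0 < r \<and> e \<in> E \<and> s = r *\<^sub>R T e" if "s \<in> S \<times> UNIV" for s
  proof -
    from that obtain s0 p q where s: "s = (s0, p, q)" "s0 \<in> S" by auto
    from S_E[OF s(2)] obtain r a b where r: "0 < r" "s0 = r *\<^sub>R (a - b)"
      and "a \<in> domain A" "b \<in> domain B" by blast
    then obtain a' b' where ab: "a' \<in> A a" "b' \<in> B b" by (auto simp: domain_def)
    \<comment> \<open>Graph points with the pairing as height lie in the epigraphs; the offsets in
      \<open>u\<close> and \<open>u'\<close> produce \<open>p\<close> and \<open>q\<close> after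
      scaling by \<open>r\<close>.\<close>
    let ?e = "((a, a', a' a), (b, b', b' b), (a - (1 / r) *\<^sub>R p, a' + b' - (1 / r) *\<^sub>R q))"
    have "?e \<in> E" using ab A B by (simp add: E_def graph_fitzpatrick_epi)
    moreover have "s = r *\<^sub>R T ?e" using r by (simp add: T s)
    ultimately show ?thesis using r(1) by blast
  qed
  moreover have "0 \<le> g e" if "e \<in> E" "T e = 0" for e
  proof -
    obtain x1 x1' t1 x2 x2' t2 u u' where e: "e = ((x1, x1', t1), (x2, x2', t2), (u, u'))"
      by (metis prod.collapse)
    with that have epi: "(x1, x1', t1) \<in> fitzpatrick_epi A" "(x2, x2', t2) \<in> fitzpatrick_epi B"
      and eq: "x2 = x1" "u = x1" "u' = x1' + x2'"
      by (auto simp: E_def T zero_prod_def)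
    \<comment> \<open>Under the constraints the linear part of the objective is at least
      \<open>(u' - z') (u - z)\<close>, and the two squares compensate for its negative
      part.\<close>
    have "\<bar>(u' - z') (u - z)\<bar> \<le> norm (u' - z') * norm (u - z)"
      using norm_blinfun[of "u' - z'" "u - z"] by simp
    also have "\<dots> \<le> (norm (u - z))\<^sup>2 / 2 + (norm (u' - z'))\<^sup>2 / 2"
      using sum_squares_bound[of "norm (u' - z')" "norm (u - z)"] by simp
    finally have "0 \<le> (u' - z') (u - z) + (norm (u - z))\<^sup>2 / 2 + (norm (u' - z'))\<^sup>2 / 2" by linarith
    with pairing_le_fitzpatrick_epi[OF A epi(1)] pairing_le_fitzpatrick_epi[OF B epi(2)]
    show ?thesis by (simp add: e g eq blinfun.bilinear_simps)
  qed
  ultimately obtain w where w: "\<And>e. e \<in> E \<Longrightarrow> 0 \<le> g e + blinfun_apply w (T e)"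
    using lagrange_multiplier[of E g "S \<times> UNIV" T] by blast
  obtain w1 w2 :: "'a dual" and w3 :: "'a dual dual"
    where w_split: "w (p, q, r) = w1 p + w2 q + w3 r" for p q r
    using dual_prod3_split[of w] by blast
  obtain v where v: "w3 = canonical_embedding v"
    using refl unfolding reflexive_space_def by (metis surjD)
  define c where "c = (norm w2)\<^sup>2 / 2 + (norm w3)\<^sup>2 / 2 + w2 v"
  define a where "a = z - v"
  define a' where "a' = z' - w2 - w1"
  \<comment> \<open>The multiplier inequality at graph points, with \<open>u\<close> and
    \<open>u'\<close> eliminated by conjugation; completing the products turns it into a sum of one
    monotonicity expression for \<open>A\<close> and one for \<open>B\<close>.\<close>
  have key: "c \<le> (a' - x1') (a - x1) + (w1 - x2') (a - x2)"
    if x: "x1' \<in> A x1" "x2' \<in> B x2" for x1 x1' x2 x2'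
  proof -
    define P where "P = x1' x1 + x2' x2 - (x1' + x2') z - z' x1 + z' z
      + w1 (x1 - x2) + w2 x1 + w3 (x1' + x2')"
    have "- P + w2 z + w3 z' \<le> (norm u)\<^sup>2 / 2 + (norm u')\<^sup>2 / 2 - w2 u - w3 u'" for u u'
    proof -
      \<comment> \<open>The shifts by \<open>z\<close> and \<open>z'\<close> centre the squares at
        0.\<close>
      have "((x1, x1', x1' x1), (x2, x2', x2' x2), (z + u, z' + u')) \<in> E"
        using x A B by (simp add: E_def graph_fitzpatrick_epi)
      from w[OF this] show ?thesis
        by (simp add: P_def g T w_split blinfun.bilinear_simps)
    qed
    from half_squares_conjugate[OF this] show ?thesis
      by (simp add: c_def P_def a_def a'_def v blinfun.bilinear_simps)
  qed
  have c: "0 \<le> c"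
  proof -
    have "\<bar>w2 v\<bar> \<le> norm w3 * norm w2"
      using norm_blinfun[of w3 w2] by (simp add: v)
    also have "\<dots> \<le> (norm w2)\<^sup>2 / 2 + (norm w3)\<^sup>2 / 2"
      using sum_squares_bound[of "norm w3" "norm w2"] by simp
    finally show ?thesis unfolding c_def by linarith
  qed
  \<comment> \<open>A point of \<open>B\<close> making its summand negative would make the summand
    of \<open>A\<close> strictly positive on the whole graph. Maximality would then put
    \<open>a'\<close> into \<open>A a\<close>, where that summand is 0.\<close>
  have w1: "w1 \<in> B a"
  proof (rule ccontr)
    assume "w1 \<notin> B a"
    then obtain x2 x2' where x2: "x2' \<in> B x2" "(w1 - x2') (a - x2) < 0"
      using maximally_monotone_memI[OF B, of w1 a] by force
    have pos: "0 < (a' - x1') (a - x1)" if "x1' \<in> A x1" for x1 x1'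
      using key[OF that x2(1)] x2(2) c by linarith
    then have "a' \<in> A a" by (intro maximally_monotone_memI[OF A]) (simp add: less_imp_le)
    from pos[OF this] show False by simp
  qed
  have "0 \<le> (a' - x1') (a - x1)" if "x1' \<in> A x1" for x1 x1'
    using key[OF that w1] c by simp
  then have a': "a' \<in> A a" by (rule maximally_monotone_memI[OF A])
  from key[OF a' w1] have "c \<le> 0" by simp
  \<comment> \<open>At the graph point \<open>a' + w1\<close> over \<open>a\<close>, the differences
    to \<open>z'\<close> and \<open>z\<close> are exactly \<open>w2\<close> and
    \<open>v\<close>.\<close>
  moreover have "0 \<le> w2 v"
    using rel[OF a' w1] by (simp add: a_def a'_def)
  ultimately have "(norm w2)\<^sup>2 / 2 + (norm w3)\<^sup>2 / 2 \<le> 0" by (simp add: c_def)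
  then have w23: "w2 = 0" "w3 = 0"
    using sum_power2_le_zero_iff[of "norm w2" "norm w3"] by simp_all
  have "v = 0"
  proof (rule ccontr)
    assume "v \<noteq> 0"
    then obtain f :: "'a dual" where "0 < f v"
      using separate_closed_subspace[of "{0}" v] by (auto simp: subspace_single_0)
    moreover have "f v = w3 f" by (simp add: v)
    ultimately show False by (simp add: w23)
  qed
  with a' w1 show ?thesis
    by (intro that[of a' w1]) (simp_all add: a_def a'_def w23)
qed

theorem theorem4p6:
  fixes A B :: "'a::banach set_valued_op"
  assumes "reflexive_space TYPE('a)"
    and "maximally_monotone A"
    and "maximally_monotone B"
    and "subspace (\<Union>r\<in>{0<..}. scaled_diff r (domain A) (domain B))"
    and "closed (\<Union>r\<in>{0<..}. scaled_diff r (domain A) (domain B))"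
  shows "maximally_monotone (op_sum A B)"
  unfolding maximally_monotone_iff
proof (intro allI iffI impI)
  fix x x' y y' assume "x' \<in> op_sum A B x" "y' \<in> op_sum A B y"
  then obtain a b c d where "a \<in> A x" "b \<in> B x" "x' = a + b" "c \<in> A y" "d \<in> B y" "y' = c + d"
    unfolding op_sum_def by blast
  with maximally_monotone_mono[OF assms(2), of a x c y] maximally_monotone_mono[OF assms(3), of b x d y]
  show "0 \<le> (x' - y') (x - y)" by (simp add: blinfun.bilinear_simps)
next
  fix z z' assume rel: "\<forall>y y'. y' \<in> op_sum A B y \<longrightarrow> 0 \<le> (z' - y') (z - y)"
  have "0 \<le> (z' - (x1 + x2)) (z - x)" if "x1 \<in> A x" "x2 \<in> B x" for x x1 x2
    using rel that unfolding op_sum_def by blast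
  from maximally_monotone_sum_mem[OF assms(1-3) refl assms(4,5) this]
  show "z' \<in> op_sum A B z" unfolding op_sum_def by blast
qed

end
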